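(* Let $(U,xyz)$ be a left unital Kantor triple system over $\mathbb{F}$ with left unit $e$, let $\rho(x)=xee$, $\mu(x)=exe$ for $x\in U$, and let $\sigma=\mu^{-1}(3\,\mathrm{id}-2\rho)$. Define a linear map $x\mapsto\bar x$ and a binary multiplication on $U$ by $$\bar x=2x-xee,\qquad x\cdot y=\bar x e y-\bar x\sigma(\bar y)e+yex,$$ for $x,y\in U$. Then $(U,\cdot,\bar{\ })$ is a structurable algebra with unity $e$, $\sigma$ is an involutive automorphism of $(U,\cdot,\bar{\ })$, and the triple product on $U$ is recovered as $$xyz=(x\cdot\sigma(\bar y))\cdot z+(z\cdot\sigma(\bar y))\cdot x-(z\cdot\bar x)\cdot\sigma(y)\qquad(\ast)$$ for any $x,y,z\in U$. Conversely, if $(A,\cdot,\bar{\ })$ is a structurable algebra over $\mathbb{F}$ endowed with an involutive automorphism $\sigma$, and $e=1$ is the unity of $A$, then $(A,xyz)$ is a left unital Kantor triple system with left unit $e$, where $xyz$ is defined by formula $(\ast)$. Moreover, $\sigma=\mu^{-1}(3\,\mathrm{id}-2\rho)$, where $\rho(x)=xee$ and $\mu(x)=exe$ for this triple product, and the involution and the multiplication of the structurable algebra are related to this triple product by $\bar x=2x-xee$ and $x\cdot y=\bar xey-\bar x\sigma(\bar y)e+yex$ for all $x,y\in A$.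
   Context: $\mathbb{F}$ is a field of characteristic not two or three. A triple system is an $\mathbb{F}$-vector space $U$ with a trilinear product $(x,y,z)\mapsto xyz$; put $L(x,y)z=xyz$ and $K(x,y)z=xzy-yzx$. It is a Kantor triple system if for all $u,v,x,y\in U$: $[L(u,v),L(x,y)]=L(uvx,y)-L(x,vuy)$ and $K(K(u,v)x,y)=K(u,v)L(x,y)+L(y,x)K(u,v)$. It is left unital with left unit $e\in U$ if $eex=x$ for all $x\in U$. For a left unital Kantor triple system the linear map $\mu:x\mapsto exe$ is bijective, so $\mu^{-1}$ makes sense. A structurable algebra over $\mathbb{F}$ is a unital (not necessarily associative) algebra with involution $(A,\cdot,\bar{\ })$ (the involution is a linear anti-automorphism with square the identity) such that for all $u,v,x,y,z\in A$: $(x-\bar x,y,z)=(y,\bar x-x,z)$ and $[V_{u,v},V_{x,y}]=V_{V_{u,v}x,y}-V_{x,V_{v,u}y}$, where $(x,y,z)=(x\cdot y)\cdot z-x\cdot(y\cdot z)$ and $V_{x,y}(z)=(x\cdot\bar y)\cdot z+(z\cdot\bar y)\cdot x-(z\cdot\bar x)\cdot y$. An automorphism of $(A,\cdot,\bar{\ })$ is an automorphism of the algebra commuting with the involution; "involutive" means that its square is the identity. *)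

theory Defs
  imports Complex_Main
begin

section \<open>Kantor triple systems\<close>

text \<open>Vector spaces over a field are given by a scalar multiplication satisfying the locale
  \<^locale>\<open>vector_space\<close>; the characteristic is not restricted here.\<close>

locale triple_system = vector_space scale
  for scale :: "'f::field \<Rightarrow> 'u::ab_group_add \<Rightarrow> 'u" +
  fixes tp :: "'u \<Rightarrow> 'u \<Rightarrow> 'u \<Rightarrow> 'u"
  assumes tp_linear1: "Vector_Spaces.linear scale scale (\<lambda>x. tp x y z)"
    and tp_linear2: "Vector_Spaces.linear scale scale (\<lambda>y. tp x y z)"
    and tp_linear3: "Vector_Spaces.linear scale scale (\<lambda>z. tp x y z)"

definition triple_L :: "('u \<Rightarrow> 'u \<Rightarrow> 'u \<Rightarrow> 'u) \<Rightarrow> 'u \<Rightarrow> 'u \<Rightarrow> 'u \<Rightarrow> 'u" where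
  "triple_L tp x y z = tp x y z"

definition triple_K :: "('u::ab_group_add \<Rightarrow> 'u \<Rightarrow> 'u \<Rightarrow> 'u) \<Rightarrow> 'u \<Rightarrow> 'u \<Rightarrow> 'u \<Rightarrow> 'u" where
  "triple_K tp x y z = tp x z y - tp y z x"

locale kantor_triple_system = triple_system +
  assumes kantor_L:
    "triple_L tp u v (triple_L tp x y z) - triple_L tp x y (triple_L tp u v z) =
     triple_L tp (tp u v x) y z - triple_L tp x (tp v u y) z"
    and kantor_K:
    "triple_K tp (triple_K tp u v x) y z =
     triple_K tp u v (triple_L tp x y z) + triple_L tp y x (triple_K tp u v z)"

locale left_unital_kantor_triple_system = kantor_triple_system scale tp
  for scale :: "'f::field \<Rightarrow> 'u::ab_group_add \<Rightarrow> 'u"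
    and tp :: "'u \<Rightarrow> 'u \<Rightarrow> 'u \<Rightarrow> 'u" +
  fixes e :: 'u
  assumes left_unit: "tp e e x = x"

definition kts_rho :: "('u \<Rightarrow> 'u \<Rightarrow> 'u \<Rightarrow> 'u) \<Rightarrow> 'u \<Rightarrow> 'u \<Rightarrow> 'u" where
  "kts_rho tp e x = tp x e e"

definition kts_mu :: "('u \<Rightarrow> 'u \<Rightarrow> 'u \<Rightarrow> 'u) \<Rightarrow> 'u \<Rightarrow> 'u \<Rightarrow> 'u" where
  "kts_mu tp e x = tp e x e"

text \<open>The inverse of \<^const>\<open>kts_mu\<close> below is a genuine inverse by lemma \<open>bij_kts_mu\<close>.\<close>

definition kts_sigma ::
  "('f::field \<Rightarrow> 'u::ab_group_add \<Rightarrow> 'u) \<Rightarrow> ('u \<Rightarrow> 'u \<Rightarrow> 'u \<Rightarrow> 'u) \<Rightarrow> 'u \<Rightarrow> 'u \<Rightarrow> 'u" where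
  "kts_sigma scale tp e x = inv (kts_mu tp e) (scale 3 x - scale 2 (kts_rho tp e x))"

definition kts_bar ::
  "('f::field \<Rightarrow> 'u::ab_group_add \<Rightarrow> 'u) \<Rightarrow> ('u \<Rightarrow> 'u \<Rightarrow> 'u \<Rightarrow> 'u) \<Rightarrow> 'u \<Rightarrow> 'u \<Rightarrow> 'u" where
  "kts_bar scale tp e x = scale 2 x - tp x e e"

definition kts_mult ::
  "('u::ab_group_add \<Rightarrow> 'u \<Rightarrow> 'u \<Rightarrow> 'u) \<Rightarrow> 'u \<Rightarrow> ('u \<Rightarrow> 'u) \<Rightarrow> ('u \<Rightarrow> 'u) \<Rightarrow> 'u \<Rightarrow> 'u \<Rightarrow> 'u" where
  "kts_mult tp e bar \<sigma> x y = tp (bar x) e y - tp (bar x) (\<sigma> (bar y)) e + tp y e x"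

lemma (in left_unital_kantor_triple_system) bij_kts_mu:
  assumes "CHAR('f) \<noteq> 3"
  shows "bij (kts_mu tp e)"
proof -
  let ?r = "kts_rho tp e" and ?m = "kts_mu tp e"
  have L: "tp u v (tp x y z) - tp x y (tp u v z) = tp (tp u v x) y z - tp x (tp v u y) z"
    for u v x y z
    using kantor_L by (simp add: triple_L_def)
  have lin1: "Vector_Spaces.linear scale scale ?r"
    unfolding kts_rho_def by (rule tp_linear1)
  have rm: "?r (?r x) = ?m (?m x)" for x
    using L[of x e e e e] by (simp add: kts_rho_def kts_mu_def left_unit)
  have rm': "?r (?m x) = ?m (?r x)" for x
    using L[of e x e e e] by (simp add: kts_rho_def kts_mu_def left_unit)
  have d1: "?r (x - y) = ?r x - ?r y" and s1: "?r (scale c x) = scale c (?r x)" for x y c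
    using lin1 Vector_Spaces.linear.axioms module_hom.diff module_hom.scale
    by (metis module_hom_iff_linear)+
  have d1': "tp (x - y) e e = tp x e e - tp y e e" for x y
    using d1[of x y] by (simp add: kts_rho_def)
  have "triple_K tp (triple_K tp u e e) e e = triple_K tp u e e + triple_K tp u e e" for u
    using kantor_K[of u e e e e] by (simp add: triple_L_def left_unit)
  then have "?r (?r u - u) - (?r u - u) = (?r u - u) + (?r u - u)" for u
    by (simp add: triple_K_def kts_rho_def left_unit)
  then have q: "?r (?r u) = (?r u + ?r u + ?r u + ?r u) - (u + u + u)" for u
    by (simp add: d1 algebra_simps)
  have three: "(3::'f) \<noteq> 0"
  proof
    assume "(3::'f) = 0"
    then have "of_nat 3 = (0::'f)" by simp
    then have "CHAR('f) dvd 3" by (simp only: of_nat_eq_0_iff_char_dvd)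
    moreover have "n = 1 \<or> n = 3" if "n dvd 3" for n :: nat
    proof -
      from that have "n \<le> 3" by (auto dest: dvd_imp_le)
      then have "n = 0 \<or> n = 1 \<or> n = 2 \<or> n = 3" by linarith
      with that show ?thesis by auto
    qed
    ultimately have "CHAR('f) = 1" using assms by blast
    then show False by simp
  qed
  let ?g = "\<lambda>x. scale (inverse 3) (scale 4 x - ?r x)"
  have t: "scale 3 u = u + u + u" for u
    using scale_left_distrib[of 1 "2" u] scale_left_distrib[of 1 1 u] by (simp add: algebra_simps)
  have f: "scale 4 u = u + u + u + u" for u
    using scale_left_distrib[of 1 "3" u] by (simp add: algebra_simps t)
  have q': "scale 4 (?r u) - ?r (?r u) = scale 3 u" for u
    by (simp add: q f t)
  have rg: "?r (?g x) = x" for x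
    using three by (simp add: s1 d1 q')
  have gr: "?g (?r x) = x" for x
    using three by (simp add: q')
  have "inj ?m"
    by (rule injI) (metis rm gr)
  moreover have "?m (?m (?g (?g x))) = x" for x
    using rm[of "?g (?g x)"] rg[of "?g x"] rg[of x] by metis
  then have "surj ?m"
    by (rule surjI)
  ultimately show ?thesis by (simp add: bij_def)
qed


section \<open>Structurable algebras\<close>

locale algebra_with_involution = vector_space scale
  for scale :: "'f::field \<Rightarrow> 'a::ab_group_add \<Rightarrow> 'a" +
  fixes mul :: "'a \<Rightarrow> 'a \<Rightarrow> 'a"
    and bar :: "'a \<Rightarrow> 'a"
    and one :: 'a
  assumes mul_linear1: "Vector_Spaces.linear scale scale (\<lambda>x. mul x y)"
    and mul_linear2: "Vector_Spaces.linear scale scale (\<lambda>y. mul x y)"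
    and mul_one_left: "mul one x = x"
    and mul_one_right: "mul x one = x"
    and bar_linear: "Vector_Spaces.linear scale scale bar"
    and bar_mul: "bar (mul x y) = mul (bar y) (bar x)"
    and bar_bar: "bar (bar x) = x"

definition associator :: "('a::ab_group_add \<Rightarrow> 'a \<Rightarrow> 'a) \<Rightarrow> 'a \<Rightarrow> 'a \<Rightarrow> 'a \<Rightarrow> 'a" where
  "associator mul x y z = mul (mul x y) z - mul x (mul y z)"

definition struct_V ::
  "('a::ab_group_add \<Rightarrow> 'a \<Rightarrow> 'a) \<Rightarrow> ('a \<Rightarrow> 'a) \<Rightarrow> 'a \<Rightarrow> 'a \<Rightarrow> 'a \<Rightarrow> 'a" where
  "struct_V mul bar x y z = mul (mul x (bar y)) z + mul (mul z (bar y)) x - mul (mul z (bar x)) y"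

locale structurable_algebra = algebra_with_involution +
  assumes skew_alternative:
    "associator mul (x - bar x) y z = associator mul y (bar x - x) z"
    and V_commutator:
    "struct_V mul bar u v (struct_V mul bar x y z) - struct_V mul bar x y (struct_V mul bar u v z) =
     struct_V mul bar (struct_V mul bar u v x) y z - struct_V mul bar x (struct_V mul bar v u y) z"

definition involution_algebra_automorphism ::
  "('f::field \<Rightarrow> 'a::ab_group_add \<Rightarrow> 'a) \<Rightarrow> ('a \<Rightarrow> 'a \<Rightarrow> 'a) \<Rightarrow> ('a \<Rightarrow> 'a) \<Rightarrow> ('a \<Rightarrow> 'a) \<Rightarrow> bool" where
  "involution_algebra_automorphism scale mul bar \<sigma> \<longleftrightarrow>
     Vector_Spaces.linear scale scale \<sigma> \<and> bij \<sigma> \<and>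
     (\<forall>x y. \<sigma> (mul x y) = mul (\<sigma> x) (\<sigma> y)) \<and> (\<forall>x. \<sigma> (bar x) = bar (\<sigma> x))"

text \<open>As usual, the identity counts as involutive.\<close>

definition involutive_automorphism ::
  "('f::field \<Rightarrow> 'a::ab_group_add \<Rightarrow> 'a) \<Rightarrow> ('a \<Rightarrow> 'a \<Rightarrow> 'a) \<Rightarrow> ('a \<Rightarrow> 'a) \<Rightarrow> ('a \<Rightarrow> 'a) \<Rightarrow> bool" where
  "involutive_automorphism scale mul bar \<sigma> \<longleftrightarrow>
     involution_algebra_automorphism scale mul bar \<sigma> \<and> (\<forall>x. \<sigma> (\<sigma> x) = x)"

definition struct_triple ::
  "('a::ab_group_add \<Rightarrow> 'a \<Rightarrow> 'a) \<Rightarrow> ('a \<Rightarrow> 'a) \<Rightarrow> ('a \<Rightarrow> 'a) \<Rightarrow> 'a \<Rightarrow> 'a \<Rightarrow> 'a \<Rightarrow> 'a" where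
  "struct_triple mul bar \<sigma> x y z =
     mul (mul x (\<sigma> (bar y))) z + mul (mul z (\<sigma> (bar y))) x - mul (mul z (bar x)) (\<sigma> y)"

end

theory Submission
  imports Defs
begin

text \<open>
  Let \<open>\<rho> x = x e e\<close> and \<open>\<mu> x = e x e\<close> in a left unital Kantor triple system. The relation
  \<open>(\<rho> - 1) (\<rho> - 3) = 0\<close> splits the space into hermitian elements (\<open>\<rho> = 1\<close>) and skew elements
  (\<open>\<rho> = 3\<close>), the eigenspaces of bar, and \<open>\<mu>\<^sup>2 = \<rho>\<^sup>2\<close> gives \<open>\<sigma>\<^sup>2 = 1\<close>, with
  \<open>\<mu> = \<sigma>\<close> on the hermitian and \<open>\<mu> = -3 \<sigma>\<close> on the skew elements.

  The second Kantor identity shows that every \<open>K(u,v)\<close> equals \<open>K(s,e)/2\<close> for the skew element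
  \<open>s = K(u,v)e\<close> (\<open>K_eq_ell\<close>). These operators, \<open>ell s\<close> below, are left multiplications by skew
  elements composed with \<open>\<sigma>\<close>, and all products \<open>x e y\<close> with a skew factor can be written with
  them. Applying \<open>L(s,e)\<close> and \<open>L(h,e)\<close> as derivations to \<open>e z e\<close> then shows that \<open>\<sigma>\<close>
  respects the products \<open>x e z\<close>; since the commutators \<open>[L(x,e), L(y,e)]\<close> recover all operators
  \<open>L(y,w)\<close>, the map \<open>\<sigma>\<close> is an automorphism of the triple product (\<open>sigma_tp\<close>).

  Consequently \<open>x (\<sigma> y) z\<close> is again a left unital Kantor triple product, with the same bar and with
  \<open>\<sigma>\<close> replaced by the identity (\<open>untwisted\<close>), and it suffices to treat that case. There the product
  \<open>h \<cdot> y\<close> is \<open>h e y\<close> for hermitian \<open>h\<close>, and \<open>s \<cdot> y\<close> is \<open>ell s y\<close> for skew \<open>s\<close>, from which bar is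
  seen to reverse products. The second Kantor identity yields skew-alternativity
  (\<open>skew_alternativeI\<close>), and symmetry considerations give \<open>L(x,y) = V(x,y)\<close>
  (\<open>tp_eq_struct_V\<close>). The commutator identity for \<open>V\<close> is then the first Kantor identity.

  Conversely, for a structurable algebra the triple product is \<open>V(x, \<sigma> y) z\<close>, and the first Kantor
  identity is the commutator identity for \<open>V\<close>. Since \<open>K(u,v)\<close> is left multiplication by the skew
  element \<open>u \<cdot> bar v - v \<cdot> bar u\<close> composed with \<open>\<sigma>\<close>, the second Kantor identity amounts to
  \<open>s V(x,y) z + V(y,x) (s z) = ((s x) \<cdot> bar y - y \<cdot> bar (s x)) z\<close> for skew \<open>s\<close> (\<open>skew_V\<close>).
  Skew-alternativity gives the special case \<open>y = 1\<close>, and since the operators \<open>V(x,1)\<close> generate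
  all the others through commutators, the general case follows up to the value at \<open>z = 1\<close>, which
  is another instance of skew-alternativity.
\<close>

section \<open>Vector spaces in characteristic other than two and three\<close>

context vector_space
begin

lemma numeral_nonzero_of_char:
  assumes "CHAR('a) \<noteq> 2" and "CHAR('a) \<noteq> 3"
  shows "(2::'a) \<noteq> 0" and "(3::'a) \<noteq> 0"
proof -
  have two: "n = 1 \<or> n = 2" if "n dvd 2" for n :: nat
  proof -
    have "n = 0 \<or> n = 1 \<or> n = 2" using dvd_imp_le[OF that] by auto
    with that show ?thesis by auto
  qed
  have three: "n = 1 \<or> n = 3" if "n dvd 3" for n :: nat
  proof -
    have "n = 0 \<or> n = 1 \<or> n = 2 \<or> n = 3" using dvd_imp_le[OF that] by auto
    with that show ?thesis by auto
  qed
  have "\<not> CHAR('a) dvd 2" "\<not> CHAR('a) dvd 3"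
    using assms two[of "CHAR('a)"] three[of "CHAR('a)"] by auto
  then have "of_nat 2 \<noteq> (0::'a)" "of_nat 3 \<noteq> (0::'a)"
    by (simp_all only: of_nat_eq_0_iff_char_dvd not_False_eq_True)
  then show "(2::'a) \<noteq> 0" and "(3::'a) \<noteq> 0" by simp_all
qed

lemma scale_two: "scale 2 x = x + x"
  using scale_left_distrib[of 1 1 x] by simp

lemma scale_three: "scale 3 x = x + x + x"
  using scale_left_distrib[of 1 2 x] by (simp add: scale_two algebra_simps)

lemma linear_simps:
  assumes "Vector_Spaces.linear scale scale f"
  shows "f (x + y) = f x + f y" "f (x - y) = f x - f y" "f (- x) = - f x" "f 0 = 0"
    "f (scale c x) = scale c (f x)"
proof -
  interpret f: module_hom scale scale f
    using assms by (simp add: module_hom_iff_linear)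
  show "f (x + y) = f x + f y" "f (x - y) = f x - f y" "f (- x) = - f x" "f 0 = 0"
    "f (scale c x) = scale c (f x)"
    by (simp_all add: f.add f.diff f.neg f.scale)
qed

lemma linearI:
  assumes "\<And>x y. f (x + y) = f x + f y" and "\<And>c x. f (scale c x) = scale c (f x)"
  shows "Vector_Spaces.linear scale scale f"
proof -
  have "module_hom scale scale f"
    by unfold_locales (simp_all add: assms)
  then show ?thesis by (simp add: module_hom_iff_linear)
qed

end

locale vector_space_char = vector_space scale
  for scale :: "'f::field \<Rightarrow> 'u::ab_group_add \<Rightarrow> 'u" +
  assumes char_ne_2: "CHAR('f) \<noteq> 2" and char_ne_3: "CHAR('f) \<noteq> 3"
begin

lemma double_cancel: "x = y" if "x + x = y + (y :: 'u)"
  using scale_left_imp_eq[of 2 x y] that numeral_nonzero_of_char(1)[OF char_ne_2 char_ne_3]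
  by (simp add: scale_two)

lemma triple_cancel: "x = y" if "x + x + x = y + y + (y :: 'u)"
  using scale_left_imp_eq[of 3 x y] that numeral_nonzero_of_char(2)[OF char_ne_2 char_ne_3]
  by (simp add: scale_three)

lemma double_zero: "x = 0" if "x + x = (0 :: 'u)"
  using double_cancel[of x 0] that by simp

lemma triple_zero: "x = 0" if "x + x + x = (0 :: 'u)"
  using triple_cancel[of x 0] that by simp

lemma self_neg_zero: "x = 0" if "x = - (x :: 'u)"
  by (rule double_zero) (use that in \<open>simp add: eq_neg_iff_add_eq_0\<close>)

lemma half_double: "scale (1/2) x + scale (1/2) x = x"
proof -
  have "scale (1/2) x + scale (1/2) x = scale (1/2 + 1/2) x"
    by (simp only: scale_left_distrib)
  also have "(1/2 + 1/2 :: 'f) = 1"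
    using numeral_nonzero_of_char[OF char_ne_2 char_ne_3] by (simp add: field_simps)
  finally show ?thesis by simp
qed

lemma involution_decomposition:
  assumes "Vector_Spaces.linear scale scale b" and "\<And>x. b (b x) = x"
  obtains h s where "b h = h" and "b s = - s" and "x = h + s"
proof
  let ?h = "scale (1/2) (x + b x)" and ?s = "scale (1/2) (x - b x)"
  show "b ?h = ?h" and "b ?s = - ?s"
    by (simp_all add: linear_simps[OF assms(1)] assms(2) add.commute
        flip: scale_minus_right)
  have "x = scale (1/2) (x + x)"
    by (simp add: scale_right_distrib half_double)
  also have "x + x = (x + b x) + (x - b x)" by simp
  finally show "x = ?h + ?s" by (simp only: scale_right_distrib)
qed

end

section \<open>The maps bar and \<open>\<sigma>\<close> of a left unital Kantor triple system\<close>

locale left_unital_kts_char =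
  left_unital_kantor_triple_system scale tp e + vector_space_char scale
  for scale :: "'f::field \<Rightarrow> 'u::ab_group_add \<Rightarrow> 'u"
    and tp :: "'u \<Rightarrow> 'u \<Rightarrow> 'u \<Rightarrow> 'u" and e :: 'u
begin

abbreviation bar :: "'u \<Rightarrow> 'u" where "bar \<equiv> kts_bar scale tp e"
abbreviation \<sigma> :: "'u \<Rightarrow> 'u" where "\<sigma> \<equiv> kts_sigma scale tp e"

lemmas tp_simps = linear_simps[OF tp_linear1] linear_simps[OF tp_linear2] linear_simps[OF tp_linear3]

lemma L_commutator:
  "tp u v (tp x y z) - tp x y (tp u v z) = tp (tp u v x) y z - tp x (tp v u y) z"
  using kantor_L by (simp add: triple_L_def)

text \<open>Eigenvectors of bar for \<open>1\<close> and \<open>-1\<close> are called hermitian and skew; these are the eigenvectors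
  of \<open>\<rho>\<close> for \<open>1\<close> and \<open>3\<close>.\<close>

lemma rho_bar: "tp x e e = x + x - bar x"
  by (simp add: kts_bar_def scale_two)

lemma bar_linear: "Vector_Spaces.linear scale scale bar"
  by (rule linearI) (simp_all add: kts_bar_def tp_simps scale_right_distrib algebra_simps
      scale_right_diff_distrib)

lemmas bar_simps = linear_simps[OF bar_linear]

lemma bar_e [simp]: "bar e = e"
  by (simp add: kts_bar_def left_unit scale_two)

text \<open>The identity for \<open>K\<close> at \<open>(x, e, e, e, e)\<close> is \<open>(\<rho> - 1) (\<rho> - 3) = 0\<close>, which says that
  bar \<open>= 2 - \<rho>\<close> squares to the identity.\<close>

lemma bar_bar [simp]: "bar (bar x) = x"
proof -
  have "triple_K tp (triple_K tp x e e) e e = triple_K tp x e e + triple_K tp x e e"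
    using kantor_K[of x e e e e] by (simp add: triple_L_def left_unit)
  then show ?thesis
    by (simp add: triple_K_def rho_bar left_unit bar_simps tp_simps algebra_simps)
qed

lemma bar_cases:
  obtains h s where "bar h = h" and "bar s = - s" and "x = h + s"
  using involution_decomposition[OF bar_linear bar_bar] by blast

lemma mu_inj: "tp e x e = tp e y e \<Longrightarrow> x = y"
  using bij_kts_mu[OF char_ne_3] by (auto simp: bij_def inj_def kts_mu_def)

lemma mu_surj: obtains x where "y = tp e x e"
  using bij_kts_mu[OF char_ne_3] by (auto simp: bij_def surj_def kts_mu_def)

lemma mu_sigma: "tp e (\<sigma> x) e = bar x + bar x - x"
proof -
  have "kts_mu tp e (\<sigma> x) = scale 3 x - scale 2 (kts_rho tp e x)"
    using bij_kts_mu[OF char_ne_3] by (simp add: kts_sigma_def bij_def surj_f_inv_f)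
  then show ?thesis
    by (simp add: kts_mu_def kts_rho_def rho_bar scale_two scale_three)
qed

lemma sigma_linear: "Vector_Spaces.linear scale scale \<sigma>"
  by (rule linearI; rule mu_inj)
    (simp_all add: tp_simps mu_sigma bar_simps scale_right_diff_distrib scale_right_distrib)

lemmas sigma_simps = linear_simps[OF sigma_linear]

lemma mu_bar: "tp e (bar x) e = bar (tp e x e)"
  using L_commutator[of e x e e e]
  by (simp add: kts_bar_def left_unit tp_simps)

lemma sigma_bar: "\<sigma> (bar x) = bar (\<sigma> x)"
  by (rule mu_inj) (simp add: mu_sigma mu_bar bar_simps)

text \<open>Since \<open>\<mu>\<^sup>2 = \<rho>\<^sup>2\<close>, inverting \<open>\<mu>\<close> in the definition of \<open>\<sigma>\<close> can be avoided: \<open>\<mu>\<close> is \<open>\<sigma>\<close> on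
  hermitian and \<open>-3 \<sigma>\<close> on skew elements.\<close>

lemma mu_bar_sigma: "tp e x e = bar (\<sigma> x) + bar (\<sigma> x) - \<sigma> x"
proof (rule mu_inj)
  have "tp e (tp e x e) e = tp (tp x e e) e e"
    using L_commutator[of x e e e e] by (simp add: left_unit)
  then show "tp e (tp e x e) e = tp e (bar (\<sigma> x) + bar (\<sigma> x) - \<sigma> x) e"
    by (simp add: tp_simps mu_bar mu_sigma rho_bar bar_simps)
qed

lemma sigma_sigma [simp]: "\<sigma> (\<sigma> x) = x"
  by (rule mu_inj) (simp only: mu_sigma[of "\<sigma> x"] mu_bar_sigma[of x])

lemma sigma_e [simp]: "\<sigma> e = e"
  by (rule mu_inj) (simp add: mu_sigma left_unit)

text \<open>The commutator of \<open>L(u,e)\<close> with \<open>L(e,e) = id\<close> vanishes, so \<open>L(\<rho> u, e) = L(e, \<mu> u)\<close>. The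
  eigenvalues of \<open>\<rho>\<close> and \<open>\<mu>\<close> on the two eigenspaces of bar turn this into the stated form.\<close>

lemma L_e_right: "tp x e z = tp e (\<sigma> (bar x)) z"
proof -
  have rm: "tp (tp u e e) e z = tp e (tp e u e) z" for u
    using L_commutator[of u e e e z] by (simp add: left_unit)
  obtain h s where hs: "bar h = h" "bar s = - s" "x = h + s"
    using bar_cases .
  have "tp h e z = tp e (\<sigma> h) z"
    using rm[of h] by (simp add: rho_bar mu_bar_sigma hs flip: sigma_bar)
  moreover have "tp s e z = - tp e (\<sigma> s) z"
    by (rule triple_cancel)
      (use rm[of s] in \<open>simp add: rho_bar mu_bar_sigma hs tp_simps sigma_simps algebra_simps
        flip: sigma_bar\<close>)
  ultimately show ?thesis
    by (simp add: hs tp_simps bar_simps sigma_simps)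
qed

lemma L_e_left: "tp e x z = tp (\<sigma> (bar x)) e z"
  by (simp add: L_e_right sigma_bar)

lemma tp_swap_e: "tp v u e = \<sigma> (bar (tp u v e))"
proof (rule mu_inj)
  have "tp (tp u v e) e e = tp e (tp v u e) e"
    using L_commutator[of u v e e e] by (simp add: left_unit)
  then show "tp e (tp v u e) e = tp e (\<sigma> (bar (tp u v e))) e"
    using L_e_right by metis
qed

section \<open>Multiplication by skew elements\<close>

text \<open>Once the algebra is available, \<open>ell s x\<close> is \<open>s \<cdot> \<sigma> x\<close> for skew \<open>s\<close>. The factor one half
  normalizes \<open>ell s e\<close> to \<open>s\<close>.\<close>

definition ell :: "'u \<Rightarrow> 'u \<Rightarrow> 'u" where
  "ell a x = scale (1/2) (tp a x e - tp e x a)"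

lemma ell_double: "ell a x + ell a x = tp a x e - tp e x a"
  by (simp add: ell_def half_double)

lemma ell_linear1: "Vector_Spaces.linear scale scale (\<lambda>a. ell a x)"
  and ell_linear2: "Vector_Spaces.linear scale scale (ell a)"
  unfolding ell_def
  by (rule linearI; simp add: tp_simps algebra_simps scale_right_diff_distrib scale_right_distrib
      scale_left_commute)+

lemmas ell_simps = linear_simps[OF ell_linear1] linear_simps[OF ell_linear2]

text \<open>The identity for \<open>K\<close> at \<open>x = y = e\<close> reads \<open>K(K(u,v)e, e) = 2 K(u,v)\<close>. Hence \<open>K(u,v)e\<close> is skew
  and determines \<open>K(u,v)\<close>.\<close>

lemma psi_skew: "bar (tp u e v - tp v e u) = - (tp u e v - tp v e u)"
proof -
  let ?p = "tp u e v - tp v e u"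
  have "tp ?p e e - tp e e ?p = ?p + ?p"
    using kantor_K[of u v e e e] by (simp add: triple_L_def triple_K_def left_unit)
  then show ?thesis
    by (simp only: rho_bar left_unit) (simp add: bar_simps algebra_simps)
qed

lemma K_eq_ell: "tp u z v - tp v z u = ell (tp u e v - tp v e u) z"
proof (rule double_cancel)
  show "(tp u z v - tp v z u) + (tp u z v - tp v z u)
      = ell (tp u e v - tp v e u) z + ell (tp u e v - tp v e u) z"
    using kantor_K[of u v e e z] by (simp add: ell_double triple_L_def triple_K_def left_unit)
qed

lemma ell_hermitian:
  assumes "bar h = h" shows "ell h z = 0"
proof (rule double_zero)
  have "tp h e e - tp e e h = 0"
    by (simp add: rho_bar assms left_unit)
  then show "ell h z + ell h z = 0"
    using K_eq_ell[of h z e] by (simp add: ell_double ell_simps)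
qed

lemma ell_e:
  assumes "bar s = - s" shows "ell s e = s"
  by (rule double_cancel) (simp add: ell_double rho_bar assms left_unit)

text \<open>As \<open>ell s\<close> is half of \<open>K(s,e)\<close>, this is the second Kantor identity for \<open>K(s,e)\<close>. Its
  specializations at \<open>e\<close> express \<open>L(s,e)\<close> and \<open>L(_,e)s\<close> through \<open>ell s\<close>, bar and \<open>\<sigma>\<close>
  for skew \<open>s\<close>.\<close>

lemma K_ell:
  "tp (ell s x) z y - tp y z (ell s x) = ell s (tp x y z) + tp y x (ell s z)"
proof (rule double_cancel)
  let ?l = "ell s x" and ?m = "ell s (tp x y z)" and ?n = "ell s z"
  have "(tp ?l z y - tp y z ?l) + (tp ?l z y - tp y z ?l) = tp (?l + ?l) z y - tp y z (?l + ?l)"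
    by (simp add: tp_simps)
  also have "\<dots> = tp (tp s x e - tp e x s) z y - tp y z (tp s x e - tp e x s)"
    by (simp only: ell_double)
  also have "\<dots> = (tp s (tp x y z) e - tp e (tp x y z) s) + tp y x (tp s z e - tp e z s)"
    using kantor_K[of s e x y z] by (simp add: triple_L_def triple_K_def)
  also have "\<dots> = (?m + ?m) + tp y x (?n + ?n)"
    by (simp only: ell_double)
  finally show "(tp ?l z y - tp y z ?l) + (tp ?l z y - tp y z ?l)
      = (?m + tp y x ?n) + (?m + tp y x ?n)"
    by (simp add: tp_simps)
qed

lemma tp_e_skew:
  assumes "bar s = - s"
  shows "tp e x s = ell s (bar x) - ell s x - bar (ell s x)"
  using K_ell[of s x e e]
  by (simp add: ell_e[OF assms] left_unit rho_bar ell_simps algebra_simps)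

lemma tp_skew_right:
  assumes "bar s = - s"
  shows "tp y e s = ell s (\<sigma> y) - ell s (bar (\<sigma> y)) - bar (ell s (bar (\<sigma> y)))"
  by (simp add: L_e_right[of y] tp_e_skew[OF assms] flip: sigma_bar)

lemma tp_skew_left:
  assumes "bar s = - s"
  shows "tp s e y = ell s (\<sigma> y) - bar (ell s (bar (\<sigma> y))) - bar (ell s (bar (\<sigma> y)))"
  using K_ell[of s e e y]
  by (simp add: ell_e[OF assms] mu_bar_sigma ell_simps tp_skew_right[OF assms] algebra_simps)

section \<open>Compatibility of \<open>\<sigma>\<close> with the triple product\<close>

text \<open>Expressing \<open>L(s,e)\<close> through \<open>ell s\<close> and bar in the commutator identity on \<open>(e, z, e)\<close> leaves a
  linear relation between \<open>d = \<sigma> (ell (\<sigma> s) (\<sigma> _)) - ell s\<close> and its composites with bar. On each of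
  the four blocks of \<open>d\<close> with respect to the eigenspaces of bar the relation is multiplication by
  one of \<open>1, -3, 9, -3\<close>, so \<open>d\<close> vanishes.\<close>

lemma sigma_ell:
  assumes s: "bar s = - s"
  shows "\<sigma> (ell s x) = ell (\<sigma> s) (\<sigma> x)"
proof -
  define d where "d z = \<sigma> (ell (\<sigma> s) (\<sigma> z)) - ell s z" for z
  have s': "bar (\<sigma> s) = - \<sigma> s"
    using s by (simp add: sigma_simps flip: sigma_bar)
  have E: "d z + d (bar z) + d (bar z) + d (bar z) + d (bar z)
      = bar (d z) + bar (d z) + bar (d (bar z)) + bar (d (bar z))" for z
  proof -
    have 1: "tp s z e = ell s z + ell s z + tp e z s"
      by (simp add: ell_double)
    have 2: "tp e s z = - tp (\<sigma> s) e z"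
      using L_e_left[of s z] by (simp add: s tp_simps sigma_simps)
    have "tp s e (tp e z e) - tp e z (tp s e e) = tp (tp s e e) z e - tp e (tp e s z) e"
      by (rule L_commutator)
    then show ?thesis
      by (simp add: rho_bar s 1 2 mu_bar_sigma tp_simps tp_e_skew[OF s] tp_skew_left[OF s]
          tp_skew_left[OF s'] d_def bar_simps sigma_simps ell_simps sigma_bar algebra_simps)
  qed
  have "d h = 0" if h: "bar h = h" for h
  proof -
    have a: "d h + d h + d h + d h + d h = bar (d h) + bar (d h) + bar (d h) + bar (d h)"
      using E[of h] by (simp add: h)
    then have "bar (d h + d h + d h + d h + d h) = bar (bar (d h) + bar (d h) + bar (d h) + bar (d h))"
      by simp
    then have b: "bar (d h) + bar (d h) + bar (d h) + bar (d h) + bar (d h) = d h + d h + d h + d h"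
      by (simp add: bar_simps)
    \<comment> \<open>The sum of the two relations puts \<open>d h\<close> in the skew part, where \<open>a\<close> becomes \<open>9 d h = 0\<close>.\<close>
    have "(d h + d h + d h + d h + d h) + (bar (d h) + bar (d h) + bar (d h) + bar (d h) + bar (d h))
        = (bar (d h) + bar (d h) + bar (d h) + bar (d h)) + (d h + d h + d h + d h)"
      by (simp only: a b)
    then have "d h + bar (d h) = 0"
      by (simp add: algebra_simps)
    then have c: "bar (d h) = - d h"
      by (simp add: eq_neg_iff_add_eq_0 add.commute)
    have "(d h + d h + d h) + (d h + d h + d h) + (d h + d h + d h) = 0"
      using a by (simp add: c algebra_simps)
    then show ?thesis
      using triple_zero by blast
  qed
  moreover have "d t = 0" if t: "bar t = - t" for t
  proof -
    have "d (- t) = - d t"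
      by (simp add: d_def ell_simps sigma_simps)
    then have "d t + d t = - d t"
      using E[of t] by (simp only: t bar_simps) (simp add: algebra_simps)
    then have "d t + d t + d t = 0"
      by simp
    then show ?thesis
      by (rule triple_zero)
  qed
  moreover have "d (h + t) = d h + d t" for h t
    by (simp add: d_def ell_simps sigma_simps)
  ultimately have "d x = 0"
    using bar_cases[of x] by (metis add.right_neutral)
  then show ?thesis
    by (metis d_def eq_iff_diff_eq_0 sigma_sigma)
qed

lemma hermitian_swap_e:
  assumes "bar h = h" shows "tp h z e = tp e z h"
  using ell_double[of h z] by (simp add: ell_hermitian[OF assms])

text \<open>On hermitian elements \<open>tp h e k\<close> will be the product \<open>h \<cdot> k\<close>, so this is the anti-automorphism
  property of bar there. It is linked to \<open>\<sigma>\<close>: the rule \<open>tp_swap_e\<close> gives the twisted form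
  \<open>twist\<close>, and the commutator identity on \<open>(e, k, e)\<close> then eliminates \<open>\<sigma>\<close>.\<close>

lemma bar_tp_hermitian:
  assumes h: "bar h = h" and k: "bar k = k"
  shows "bar (tp k e h) = tp h e k"
    and "\<sigma> (tp h e k) = tp (\<sigma> h) e (\<sigma> k)"
proof -
  have twist: "tp (\<sigma> h) e (\<sigma> k) = \<sigma> (bar (tp k e h))"
    if h: "bar h = h" and k: "bar k = k" for h k
  proof -
    have "tp (\<sigma> h) e (\<sigma> k) = tp e h (\<sigma> k)"
      by (simp add: L_e_left[of h] h)
    also have "\<dots> = tp (\<sigma> k) h e"
      using k by (simp add: hermitian_swap_e flip: sigma_bar)
    also have "\<dots> = \<sigma> (bar (tp h (\<sigma> k) e))"
      by (rule tp_swap_e)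
    also have "tp h (\<sigma> k) e = tp e (\<sigma> k) h"
      by (simp add: hermitian_swap_e h)
    also have "\<dots> = tp k e h"
      by (simp add: L_e_right[of k] k)
    finally show ?thesis .
  qed
  have bar_tp: "bar (tp (\<sigma> k) e h) = tp h e (\<sigma> k)" if k: "bar k = k" for k
  proof -
    have sk: "bar (\<sigma> k) = \<sigma> k"
      using k by (simp flip: sigma_bar)
    have 1: "tp e k e = \<sigma> k" "tp h e e = h"
      by (simp_all add: mu_bar_sigma sk rho_bar h)
    have 2: "tp e k h = tp (\<sigma> k) e h"
      using k by (simp add: L_e_left[of k])
    have "tp e h k = tp (\<sigma> h) e (\<sigma> (\<sigma> k))"
      using h by (simp add: L_e_left[of h])
    also have "\<dots> = \<sigma> (bar (tp (\<sigma> k) e h))"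
      by (rule twist[OF h sk])
    finally have 3: "tp e h k = \<sigma> (bar (tp (\<sigma> k) e h))" .
    have "tp h e (tp e k e) - tp e k (tp h e e) = tp (tp h e e) k e - tp e (tp e h k) e"
      by (rule L_commutator)
    then show ?thesis
      by (simp add: 1 2 3 hermitian_swap_e[OF h] left_unit mu_sigma algebra_simps)
  qed
  show bk: "bar (tp k e h) = tp h e k"
    using bar_tp[of "\<sigma> k"] k by (simp flip: sigma_bar)
  show "\<sigma> (tp h e k) = tp (\<sigma> h) e (\<sigma> k)"
    by (simp add: twist[OF h k] bk)
qed

lemma sigma_tp_e: "\<sigma> (tp x e z) = tp (\<sigma> x) e (\<sigma> z)"
proof -
  obtain h s where x: "bar h = h" "bar s = - s" "x = h + s"
    using bar_cases .
  obtain k t where z: "bar k = k" "bar t = - t" "z = k + t"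
    using bar_cases .
  have skew: "bar (\<sigma> r) = - \<sigma> r" if "bar r = - r" for r
    using that by (simp add: sigma_simps flip: sigma_bar)
  have "\<sigma> (tp s e z) = tp (\<sigma> s) e (\<sigma> z)"
    by (simp add: tp_skew_left x(2) skew sigma_simps sigma_bar sigma_ell)
  moreover have "\<sigma> (tp h e t) = tp (\<sigma> h) e (\<sigma> t)"
    by (simp add: tp_skew_right z(2) skew sigma_simps sigma_bar sigma_ell)
  moreover have "\<sigma> (tp h e k) = tp (\<sigma> h) e (\<sigma> k)"
    by (rule bar_tp_hermitian[OF x(1) z(1)])
  ultimately show ?thesis
    by (simp add: x(3) z(3) tp_simps sigma_simps)
qed

text \<open>The commutator \<open>[L(w,e), L(a,e)]\<close> expresses every \<open>L(a, \<mu> w)\<close>, hence every \<open>L(a,y)\<close>, through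
  operators of the form \<open>L(_,e)\<close>, with which \<open>\<sigma>\<close> is already compatible.\<close>

lemma sigma_tp: "\<sigma> (tp x y z) = tp (\<sigma> x) (\<sigma> y) (\<sigma> z)"
proof -
  obtain w where y: "y = tp e w e"
    using mu_surj .
  have L: "tp a (tp e v e) c
      = tp (tp v e a) e c - tp v e (tp a e c) + tp a e (tp v e c)" for a v c
    using L_commutator[of v e a e c] by (simp add: algebra_simps)
  have "\<sigma> (tp e w e) = tp e (\<sigma> w) e"
    by (simp add: mu_bar_sigma sigma_simps sigma_bar)
  then show ?thesis
    by (simp add: y L sigma_simps sigma_tp_e)
qed

end

section \<open>Skew-alternativity in algebras with involution\<close>

locale involutive_algebra_char =
  algebra_with_involution scale mul bar one + vector_space_char scale
  for scale :: "'f::field \<Rightarrow> 'a::ab_group_add \<Rightarrow> 'a"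
    and mul :: "'a \<Rightarrow> 'a \<Rightarrow> 'a" and bar :: "'a \<Rightarrow> 'a" and one :: 'a
begin

lemmas mul_simps = linear_simps[OF mul_linear1] linear_simps[OF mul_linear2]
lemmas bar_simps = linear_simps[OF bar_linear]

declare bar_bar [simp] mul_one_left [simp] mul_one_right [simp]

lemma bar_one [simp]: "bar one = one"
  by (metis bar_bar bar_mul mul_one_left mul_one_right)

lemma bar_cases:
  obtains h s where "bar h = h" and "bar s = - s" and "x = h + s"
  using involution_decomposition[OF bar_linear bar_bar] by blast

text \<open>This is the operator \<open>V(x,1)\<close> of structurable algebras.\<close>

definition T :: "'a \<Rightarrow> 'a \<Rightarrow> 'a" where
  "T x z = mul x z + mul z (x - bar x)"

abbreviation asc where "asc \<equiv> associator mul"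

lemma asc_simps:
  "asc (x + x') y z = asc x y z + asc x' y z" "asc (- x) y z = - asc x y z"
  "asc x (y + y') z = asc x y z + asc x y' z" "asc x (- y) z = - asc x y z"
  "asc x y (z + z') = asc x y z + asc x y z'" "asc x y (- z) = - asc x y z"
  "asc (x - x') y z = asc x y z - asc x' y z" "asc x (y - y') z = asc x y z - asc x y' z"
  "asc x y (z - z') = asc x y z - asc x y z'"
  by (simp_all add: associator_def mul_simps)

lemma bar_asc: "bar (asc x y z) = - asc (bar z) (bar y) (bar x)"
  by (simp add: associator_def bar_simps bar_mul)

text \<open>In terms of associators the hypothesis is \<open>(s,x,z) + (bar x,s,z) + (s,z,x - bar x) = 0\<close>.
  For hermitian \<open>x\<close> this is skew-alternativity. For skew \<open>x = t\<close> it reads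
  \<open>(s,t,z) + 2(s,z,t) = (t,s,z)\<close>. If \<open>z\<close> is hermitian, the case already done and the involution
  give \<open>(s,z,t) = - (s,t,z)\<close>. If \<open>z\<close> is skew, the six instances obtained by permuting
  \<open>s, t, z\<close> force the associator to be alternating on skew elements.\<close>

lemma skew_alternativeI:
  assumes ST: "\<And>s x z. bar s = - s \<Longrightarrow>
      mul s (T x z) + T (bar x) (mul s z) = mul (mul s x + mul (bar x) s) z"
  shows "asc (x - bar x) y z = asc y (bar x - x) z"
proof -
  have herm: "asc s h z = - asc h s z" if "bar s = - s" "bar h = h" for s h z
    using ST[OF that(1), of h z] that(2)
    by (simp add: T_def associator_def mul_simps algebra_simps)
  have herm': "asc z h s = - asc z s h" if "bar s = - s" "bar h = h" for s h z
  proof -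
    have "bar (asc s h (bar z)) = bar (- asc h s (bar z))"
      using herm[OF that] by simp
    then show ?thesis
      by (simp add: bar_asc bar_simps that asc_simps)
  qed
  have skew: "asc s t z + asc s z t + asc s z t = asc t s z" if "bar s = - s" "bar t = - t" for s t z
    using ST[OF that(1), of t z] that(2)
    by (simp add: T_def associator_def mul_simps bar_simps algebra_simps)
  have main: "asc s y z = - asc y s z" if s: "bar s = - s" for s y z
  proof -
    obtain h t where y: "bar h = h" "bar t = - t" "y = h + t"
      using bar_cases .
    obtain k r where z: "bar k = k" "bar r = - r" "z = k + r"
      using bar_cases .
    have 1: "asc s t k = - asc t s k"
    proof -
      have "asc s k t = - asc s t k"
        by (rule herm'[OF y(2) z(1)])
      then have "asc t s k = - asc s t k"
        using skew[OF s y(2), of k] by simp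
      then show ?thesis
        by simp
    qed
    have 2: "asc s t r = - asc t s r"
    proof -
      have c: "asc t s r = asc s t r + asc s r t + asc s r t"
        using skew[OF s y(2), of r] by simp
      have "(asc t r s + asc s r t) + (asc t r s + asc s r t) = 0"
        using skew[OF y(2) s, of r] by (simp add: c algebra_simps)
      then have "asc t r s + asc s r t = 0"
        by (rule double_zero)
      then have d: "asc t r s = - asc s r t"
        by (simp only: eq_neg_iff_add_eq_0)
      have g: "asc r s t = asc s r t + asc s t r + asc s t r"
        using skew[OF s z(2), of t] by simp
      have k: "asc r t s = asc t r s + asc t s r + asc t s r"
        using skew[OF y(2) z(2), of s] by simp
      have "asc r s t + asc r t s + asc r t s = asc s r t"
        using skew[OF z(2) s, of t] .
      \<comment> \<open>Once the other four associators are eliminated, the last permutation says that six times the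
        sum is zero.\<close>
      then have "(asc s t r + asc s r t + (asc s t r + asc s r t))
          + (asc s t r + asc s r t + (asc s t r + asc s r t))
          + (asc s t r + asc s r t + (asc s t r + asc s r t)) = 0"
        by (simp add: g k d c algebra_simps)
      then have "asc s t r + asc s r t = 0"
        by (metis triple_zero double_zero)
      then have "asc s r t = - asc s t r"
        by (simp add: eq_neg_iff_add_eq_0 add.commute)
      then show ?thesis
        by (simp add: c)
    qed
    show ?thesis
      by (simp add: y(3) z(3) asc_simps herm[OF s y(1)] 1 2 algebra_simps)
  qed
  have "bar (x - bar x) = - (x - bar x)"
    by (simp add: bar_simps)
  from main[OF this, of y z] show ?thesis
    by (simp add: associator_def mul_simps)
qed

lemma skew_left:
  assumes SA: "\<And>x y z. asc (x - bar x) y z = asc y (bar x - x) z"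
    and s: "bar s = - s"
  shows "asc s y z = - asc y s z"
proof (rule double_cancel)
  have "asc (s + s) y z = asc y (- (s + s)) z"
    using SA[of s y z] s by simp
  then show "asc s y z + asc s y z = - asc y s z + - asc y s z"
    by (simp only: asc_simps minus_add_distrib)
qed

lemma skew_right:
  assumes SA: "\<And>x y z. asc (x - bar x) y z = asc y (bar x - x) z"
    and s: "bar s = - s"
  shows "asc z y s = - asc z s y"
proof -
  have "bar (asc s (bar y) (bar z)) = bar (- asc (bar y) s (bar z))"
    by (simp add: skew_left[OF SA s])
  then show ?thesis
    by (simp add: bar_asc bar_simps s asc_simps)
qed

end

section \<open>The structurable algebra of a triple system with trivial \<open>\<sigma>\<close>\<close>

locale untwisted_kts = left_unital_kts_char scale tp e
  for scale :: "'f::field \<Rightarrow> 'u::ab_group_add \<Rightarrow> 'u"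
    and tp :: "'u \<Rightarrow> 'u \<Rightarrow> 'u \<Rightarrow> 'u" and e :: 'u +
  assumes sigma_id [simp]: "kts_sigma scale tp e x = x"
begin

abbreviation mul where "mul \<equiv> kts_mult tp e bar (\<lambda>x. x)"

text \<open>All terms become operators \<open>L(_,e)\<close> or \<open>ell\<close>, for which the formulas on hermitian and skew
  arguments are available.\<close>

lemma mul_expand:
  "mul x y = tp (bar x) e y + tp y e x - bar (tp x e (bar y))
    - bar (ell (bar y) (bar x)) - bar (ell (bar y) (bar x))"
proof -
  have "tp (bar x) (bar y) e = bar (tp (bar y) (bar x) e)"
    using tp_swap_e[of "bar x" "bar y"] by simp
  also have "tp (bar y) (bar x) e
      = tp e (bar x) (bar y) + ell (bar y) (bar x) + ell (bar y) (bar x)"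
    by (simp add: ell_double add.assoc)
  also have "tp e (bar x) (bar y) = tp x e (bar y)"
    by (simp add: L_e_left)
  finally show ?thesis
    by (simp add: kts_mult_def bar_simps)
qed

text \<open>The formulas \<open>tp_skew_left\<close> and \<open>tp_skew_right\<close> both evaluate \<open>tp s e t\<close> when \<open>s\<close> and \<open>t\<close>
  are skew; comparing them is what links \<open>ell s t\<close> with \<open>ell t s\<close>.\<close>

lemma bar_ell:
  assumes s: "bar s = - s" and t: "bar t = - t"
  shows "bar (ell s t) = ell t s"
proof (rule triple_cancel)
  have 1: "ell s t + bar (ell s t) + bar (ell s t) = ell t s + ell t s + bar (ell t s)"
    using tp_skew_left[OF s, of t] tp_skew_right[OF t, of s]
    by (simp add: s t ell_simps bar_simps)
  have 2: "ell t s + bar (ell t s) + bar (ell t s) = ell s t + ell s t + bar (ell s t)"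
    using tp_skew_left[OF t, of s] tp_skew_right[OF s, of t]
    by (simp add: s t ell_simps bar_simps)
  have "(ell s t + bar (ell s t) + bar (ell s t)) + (ell s t + bar (ell s t) + bar (ell s t))
     + (ell t s + bar (ell t s) + bar (ell t s))
     = (ell t s + ell t s + bar (ell t s)) + (ell t s + ell t s + bar (ell t s))
      + (ell s t + ell s t + bar (ell s t))"
    by (simp only: 1 2)
  then show "bar (ell s t) + bar (ell s t) + bar (ell s t) = ell t s + ell t s + ell t s"
    by (simp add: algebra_simps)
qed

lemma mul_linear:
  "Vector_Spaces.linear scale scale (\<lambda>x. mul x y)"
  "Vector_Spaces.linear scale scale (mul x)"
  unfolding kts_mult_def
  by (rule linearI; simp add: tp_simps bar_simps algebra_simps scale_right_diff_distrib
      scale_right_distrib)+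

lemmas mul_simps = linear_simps[OF mul_linear(1)] linear_simps[OF mul_linear(2)]

lemma mul_skew:
  assumes s: "bar s = - s"
  shows "mul s y = ell s y"
proof -
  obtain k t where y: "bar k = k" "bar t = - t" "y = k + t"
    using bar_cases .
  have "mul s k = ell s k"
    by (simp add: mul_expand s y(1) tp_skew_left[OF s] tp_skew_right[OF s] ell_hermitian
        tp_simps ell_simps bar_simps algebra_simps)
  moreover have "mul s t = ell s t"
    by (simp add: mul_expand s y(2) tp_skew_left[OF s] tp_skew_right[OF s] bar_ell[OF s y(2), symmetric]
        tp_simps ell_simps bar_simps algebra_simps)
  ultimately show ?thesis
    by (simp add: y(3) mul_simps ell_simps)
qed

lemma tp_hermitian_skew:
  assumes "bar h = h" and s: "bar s = - s"
  shows "tp h e s = - bar (ell s h)"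
  by (simp add: tp_skew_right[OF s] assms(1))

lemma mul_hermitian:
  assumes h: "bar h = h"
  shows "mul h y = tp h e y"
proof -
  obtain k t where y: "bar k = k" "bar t = - t" "y = k + t"
    using bar_cases .
  have "mul h k = tp h e k"
    by (simp add: mul_expand h y(1) ell_hermitian bar_tp_hermitian(1) bar_simps)
  moreover have "mul h t = tp h e t"
    by (simp add: mul_expand h y(2) tp_skew_left[OF y(2)] tp_hermitian_skew
        tp_simps ell_simps bar_simps algebra_simps)
  ultimately show ?thesis
    by (simp add: y(3) mul_simps tp_simps)
qed

lemma bar_mul: "bar (mul x y) = mul (bar y) (bar x)"
proof -
  obtain h s where x: "bar h = h" "bar s = - s" "x = h + s"
    using bar_cases .
  obtain k t where y: "bar k = k" "bar t = - t" "y = k + t"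
    using bar_cases .
  show ?thesis
    by (simp add: x y bar_simps mul_simps mul_skew mul_hermitian bar_tp_hermitian(1)
        tp_hermitian_skew bar_ell)
qed

sublocale alg: involutive_algebra_char scale mul bar e
proof (intro involutive_algebra_char.intro algebra_with_involution.intro
    algebra_with_involution_axioms.intro vector_space_axioms vector_space_char_axioms)
  show "mul e x = x" for x
    by (simp add: mul_hermitian left_unit)
  show "mul x e = x" for x
    by (simp add: kts_mult_def left_unit)
qed (simp_all add: mul_linear bar_linear bar_mul)

lemma tp_e_eq_T: "tp x e z = alg.T x z"
proof -
  obtain h s where x: "bar h = h" "bar s = - s" "x = h + s"
    using bar_cases .
  have "tp s e z = mul s z + mul z s + mul z s"
    using bar_mul[of s "bar z"]
    by (simp add: tp_skew_left x(2) mul_skew mul_simps)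
  then show ?thesis
    by (simp add: alg.T_def x mul_simps tp_simps bar_simps mul_hermitian)
qed

lemma K_eq_mul: "tp x y z - tp z y x = mul (mul x (bar z) - mul z (bar x)) y"
proof -
  have "tp x e z - tp z e x = mul x (bar z) - mul z (bar x)"
    by (simp add: tp_e_eq_T alg.T_def mul_simps)
  then show ?thesis
    using K_eq_ell[of x y z] mul_skew[OF psi_skew[of x z]] by simp
qed

lemma skew_T:
  assumes s: "bar s = - s"
  shows "mul s (alg.T x z) + alg.T (bar x) (mul s z) = mul (mul s x + mul (bar x) s) z"
proof -
  have "mul s (alg.T x z) + alg.T (bar x) (mul s z) = ell s (tp x e z) + tp (bar x) e (ell s z)"
    by (simp add: tp_e_eq_T mul_skew[OF s])
  also have "tp (bar x) e (ell s z) = tp e x (ell s z)"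
    by (simp add: L_e_left)
  also have "ell s (tp x e z) + tp e x (ell s z) = tp (mul s x) z e - tp e z (mul s x)"
    by (simp add: K_ell mul_skew[OF s])
  also have "\<dots> = mul (mul s x + mul (bar x) s) z"
    by (simp add: K_eq_mul bar_mul s mul_simps)
  finally show ?thesis .
qed

lemmas skew_alternative = alg.skew_alternativeI[OF skew_T]

text \<open>The difference \<open>D\<close> of the two sides is symmetric in its outer arguments because both sides have
  the same \<open>K\<close>. The commutator \<open>[L(x,e), L(y,e)]\<close> relates \<open>L(y,x)\<close> and \<open>L(x,y)\<close> and gives a sign
  or a factor three when the first two arguments of \<open>D\<close> are exchanged, depending on whether they
  are hermitian (\<open>h, k, l\<close>) or skew (\<open>s, t, r\<close>). These symmetries are incompatible unless
  \<open>D = 0\<close>.\<close>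

lemma tp_eq_struct_V: "tp x y z = struct_V mul bar x y z"
proof -
  define D where "D x y z = tp x y z - struct_V mul bar x y z" for x y z
  have D_add: "D (x + x') y z = D x y z + D x' y z" "D x (y + y') z = D x y z + D x y' z"
    "D x y (z + z') = D x y z + D x y z'" for x x' y y' z z'
    by (simp_all add: D_def struct_V_def tp_simps mul_simps bar_simps)
  have swap: "D x y z = D z y x" for x y z
    using K_eq_mul[of x y z]
    by (simp add: D_def struct_V_def mul_simps algebra_simps)
  have L: "tp y (bar x + bar x - x) z
      = alg.T (alg.T x y) z - alg.T x (alg.T y z) + alg.T y (alg.T x z)" for x y z
    using L_commutator[of x e y e z]
    by (simp add: mu_bar_sigma algebra_simps flip: tp_e_eq_T)
  \<comment> \<open>In each of the next three facts, adding \<open>L\<close> to its instance with \<open>x\<close> and \<open>y\<close> exchanged cancels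
    the commutator of the two operators \<open>T\<close>.\<close>
  have HH: "D h k z = - D k h z" if h: "bar h = h" and k: "bar k = k" for h k z
  proof -
    have 1: "tp h k z = alg.T (alg.T k h) z - alg.T k (alg.T h z) + alg.T h (alg.T k z)"
      using L[of h k z] k by simp
    have 2: "tp k h z = alg.T (alg.T h k) z - alg.T h (alg.T k z) + alg.T k (alg.T h z)"
      using L[of k h z] h by simp
    show ?thesis
      by (simp add: 1 2 h k D_def struct_V_def alg.T_def mul_simps bar_simps bar_mul algebra_simps)
  qed
  have SS: "D s t z = - D t s z" if s: "bar s = - s" and t: "bar t = - t" for s t z
  proof -
    have L3: "tp t s z + tp t s z + tp t s z
        = - (alg.T (alg.T s t) z - alg.T s (alg.T t z) + alg.T t (alg.T s z))"
      if "bar s = - s" for s t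
    proof -
      have "tp t s z + tp t s z + tp t s z = - tp t (bar s + bar s - s) z"
        by (simp add: that tp_simps)
      then show ?thesis
        by (simp only: L)
    qed
    have "tp s t z + tp t s z = - mul (mul s t + mul t s) z"
    proof (rule triple_cancel)
      have "(tp s t z + tp t s z) + (tp s t z + tp t s z) + (tp s t z + tp t s z)
          = (tp s t z + tp s t z + tp s t z) + (tp t s z + tp t s z + tp t s z)"
        by (simp add: algebra_simps)
      also have "\<dots> = - (alg.T (alg.T s t + alg.T t s) z)"
        by (simp only: L3 s t) (simp add: alg.T_def mul_simps bar_simps algebra_simps)
      also have "alg.T s t + alg.T t s = (mul s t + mul t s) + (mul s t + mul t s) + (mul s t + mul t s)"
        by (simp add: s t alg.T_def mul_simps algebra_simps)
      finally show "(tp s t z + tp t s z) + (tp s t z + tp t s z) + (tp s t z + tp t s z)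
        = - mul (mul s t + mul t s) z + - mul (mul s t + mul t s) z + - mul (mul s t + mul t s) z"
        by (simp add: s t alg.T_def mul_simps bar_simps bar_mul algebra_simps)
    qed
    then have "tp s t z = - mul (mul s t + mul t s) z - tp t s z"
      by (simp add: algebra_simps)
    then show ?thesis
      by (simp add: s t D_def struct_V_def mul_simps)
  qed
  have SH: "D s h z = D h s z + D h s z + D h s z" if s: "bar s = - s" and h: "bar h = h" for s h z
  proof -
    have alt: "mul (mul z h) s = mul z (mul s h) + mul z (mul h s) - mul (mul z s) h"
      using alg.skew_right[OF skew_alternative s, of z h]
      by (simp add: associator_def algebra_simps)
    have 1: "tp s h z = alg.T (alg.T h s) z - alg.T h (alg.T s z) + alg.T s (alg.T h z)"
      using L[of s h z] h by simp
    have 2: "tp h s z + tp h s z + tp h s z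
        = - (alg.T (alg.T s h) z - alg.T s (alg.T h z) + alg.T h (alg.T s z))"
    proof -
      have "tp h s z + tp h s z + tp h s z = - tp h (bar s + bar s - s) z"
        by (simp add: s tp_simps)
      then show ?thesis
        by (simp only: L)
    qed
    have "tp s h z = (tp h s z + tp h s z + tp h s z) + alg.T (alg.T h s + alg.T s h) z"
      by (simp only: 1 2) (simp add: alg.T_def mul_simps bar_simps)
    then show ?thesis
      by (simp add: s h D_def struct_V_def alg.T_def mul_simps bar_simps bar_mul alt algebra_simps)
  qed
  have HHH: "D h k l = 0" if "bar h = h" "bar k = k" "bar l = l" for h k l
    using HH swap that by (intro self_neg_zero) metis
  have SSS: "D s t r = 0" if "bar s = - s" "bar t = - t" "bar r = - r" for s t r
    using SS swap that by (intro self_neg_zero) metis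
  have HKS: "D h k s = 0" "D s h k = 0" "D h s k = 0"
    if h: "bar h = h" and k: "bar k = k" and s: "bar s = - s" for h k s
  proof -
    have *: "D h k s = D h s k + D h s k + D h s k"
      if h: "bar h = h" and k: "bar k = k" for h k
      using SH[OF s k, of h] swap by metis
    have "D k h s = D h k s"
      by (simp only: *[OF h k] *[OF k h] swap[of h s k])
    then show z: "D h k s = 0"
      using HH[OF h k, of s] by (intro self_neg_zero) simp
    show "D h s k = 0"
      by (rule triple_zero) (use *[OF h k] z in simp)
    have "D k h s = 0"
      using HH[OF h k, of s] z by simp
    then show "D s h k = 0"
      using swap by metis
  qed
  have STH: "D s t h = 0" "D h s t = 0" "D s h t = 0"
    if s: "bar s = - s" and t: "bar t = - t" and h: "bar h = h" for s t h
  proof -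
    have *: "D s h t = D t s h + D t s h + D t s h"
      if s: "bar s = - s" and t: "bar t = - t" for s t
      using SH[OF s h, of t] swap by metis
    have "D t s h + D t s h + D t s h = D s t h + D s t h + D s t h"
      using *[OF s t] *[OF t s] swap by metis
    then have "D t s h = D s t h"
      by (rule triple_cancel)
    then show z: "D s t h = 0"
      using SS[OF s t, of h] by (intro self_neg_zero) simp
    then have "D t s h = 0"
      using SS[OF s t, of h] by simp
    then show "D s h t = 0" "D h s t = 0"
      using *[OF s t] swap[of h s t] by simp_all
  qed
  obtain h s where x: "bar h = h" "bar s = - s" "x = h + s"
    using bar_cases .
  obtain k t where y: "bar k = k" "bar t = - t" "y = k + t"
    using bar_cases .
  obtain l r where z: "bar l = l" "bar r = - r" "z = l + r"
    using bar_cases .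
  have "D x y z = 0"
    by (simp add: x(3) y(3) z(3) D_add HHH SSS HKS STH x(1,2) y(1,2) z(1,2))
  then show ?thesis
    by (simp add: D_def)
qed

lemma structurable: "structurable_algebra scale mul bar e"
proof unfold_locales
  show "alg.asc (x - bar x) y z = alg.asc y (bar x - x) z" for x y z
    by (rule skew_alternative)
  show "struct_V mul bar u v (struct_V mul bar x y z) - struct_V mul bar x y (struct_V mul bar u v z) =
     struct_V mul bar (struct_V mul bar u v x) y z - struct_V mul bar x (struct_V mul bar v u y) z"
    for u v x y z
    using L_commutator[of u v x y z] by (simp only: tp_eq_struct_V)
qed

end

section \<open>The Kantor triple system of a structurable algebra with involutive automorphism\<close>

locale structurable_char =
  structurable_algebra scale mul bar one + vector_space_char scale
  for scale :: "'f::field \<Rightarrow> 'a::ab_group_add \<Rightarrow> 'a"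
    and mul :: "'a \<Rightarrow> 'a \<Rightarrow> 'a" and bar :: "'a \<Rightarrow> 'a" and one :: 'a
begin

sublocale involutive_algebra_char scale mul bar one ..

abbreviation V where "V \<equiv> struct_V mul bar"

lemma asc_skew_left: "bar s = - s \<Longrightarrow> asc s y z = - asc y s z"
  using skew_left skew_alternative by blast

lemma asc_skew_right: "bar s = - s \<Longrightarrow> asc z y s = - asc z s y"
  using skew_right skew_alternative by blast

lemma V_one_right: "V x one z = T x z"
  by (simp add: struct_V_def T_def mul_simps)

lemma V_one_left: "V one y z = T (bar y) z"
  by (simp add: struct_V_def T_def mul_simps)

lemma T_linear:
  "Vector_Spaces.linear scale scale (\<lambda>x. T x z)" "Vector_Spaces.linear scale scale (T x)"
  unfolding T_def
  by (rule linearI; simp add: mul_simps bar_simps algebra_simps scale_right_diff_distrib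
      scale_right_distrib)+

lemmas T_simps = linear_simps[OF T_linear(1)] linear_simps[OF T_linear(2)]

lemma skew_T:
  assumes s: "bar s = - s"
  shows "mul s (T x z) + T (bar x) (mul s z) = mul (mul s x + mul (bar x) s) z"
proof -
  obtain h t where x: "bar h = h" "bar t = - t" "x = h + t"
    using bar_cases .
  have "mul s (T h z) + T (bar h) (mul s z) = mul (mul s h + mul (bar h) s) z"
    using asc_skew_left[OF s, of h z]
    by (simp add: T_def x(1) associator_def mul_simps algebra_simps)
  moreover have "mul s (T t z) + T (bar t) (mul s z) = mul (mul s t + mul (bar t) s) z"
  proof -
    have "asc s t z - asc t s z + (asc s z t + asc s z t) = 0"
      using asc_skew_left[OF s, of t z] asc_skew_right[OF x(2), of s z] by simp
    then show ?thesis
      by (simp add: T_def x(2) associator_def mul_simps bar_simps algebra_simps)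
  qed
  ultimately show ?thesis
    by (simp add: x(3) T_simps mul_simps bar_simps algebra_simps)
qed

lemma V_commutator_right:
  "V y (bar x + bar x - x) z = T (T x y) z - T x (T y z) + T y (T x z)"
  using V_commutator[of x one y one z]
  by (simp add: V_one_right V_one_left) (simp add: T_def algebra_simps)

lemma V_commutator_left:
  "V (bar x + bar x - x) y z
    = T (bar x) (T (bar y) z) - T (bar y) (T (bar x) z) + T (bar (T x y)) z"
  using V_commutator[of one x one y z]
  by (simp add: V_one_right V_one_left) (simp add: T_def algebra_simps)

lemma mu_cases:
  obtains w where "y = bar w + bar w - w"
proof -
  obtain h s where y: "bar h = h" "bar s = - s" "y = h + s"
    using bar_cases .
  define r where "r = scale (1/3) s"
  have "r + r + r = scale (3 * (1/3)) s"
    unfolding r_def by (simp only: scale_scale flip: scale_three)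
  then have r: "r + r + r = s"
    using numeral_nonzero_of_char(2)[OF char_ne_2 char_ne_3] by simp
  have "bar r = - r"
    by (simp add: r_def bar_simps y)
  then have "y = bar (h - r) + bar (h - r) - (h - r)"
    by (simp add: bar_simps y r[symmetric] algebra_simps)
  then show ?thesis ..
qed

text \<open>The commutators of \<open>V(x,1)\<close> and of \<open>V(1,x)\<close> write every \<open>V(x,y)\<close> and \<open>V(y,x)\<close> through operators
  \<open>T\<close>. By \<open>skew_T\<close>, left multiplication by a skew element can be moved past each \<open>T\<close> at the
  price of another left multiplication, and in the sum the terms that are not left
  multiplications cancel. So the left-hand side is \<open>r \<cdot> z\<close> for some \<open>r\<close>; evaluation at the unity
  identifies \<open>r\<close>, using skew-alternativity only.\<close>

lemma skew_V:
  assumes s: "bar s = - s"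
  shows "mul s (V x y z) + V y x (mul s z) = mul (mul (mul s x) (bar y) - mul y (bar (mul s x))) z"
proof -
  define \<phi> where "\<phi> t u = mul t u + mul (bar u) t" for t u
  have \<phi>: "mul t (T u v) = mul (\<phi> t u) v - T (bar u) (mul t v)" if "bar t = - t" for t u v
    using skew_T[OF that, of u v] by (simp add: \<phi>_def algebra_simps)
  have skew: "bar (\<phi> t u) = - \<phi> t u" if "bar t = - t" for t u
    by (simp add: \<phi>_def bar_simps bar_mul that mul_simps)
  obtain w where y: "y = bar w + bar w - w"
    using mu_cases .
  \<comment> \<open>Moving \<open>s\<close> past \<open>T (T w x)\<close> and past the commutator of \<open>T w\<close> and \<open>T x\<close> leaves these factors.\<close>
  define r where "r = \<phi> s (T w x) - \<phi> (\<phi> s w) x + \<phi> (\<phi> s x) w"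
  have r: "mul s (V x y z) + V y x (mul s z) = mul r z" for z
    unfolding y V_commutator_right V_commutator_left r_def
    by (simp add: mul_simps \<phi> s skew T_simps)
  have "r = mul s (V x y one) + V y x s"
    using r[of one] by simp
  also have "\<dots> = mul (mul s x) (bar y) - mul y (bar (mul s x))"
  proof -
    obtain h t where x: "bar h = h" "bar t = - t" "x = h + t"
      using bar_cases .
    obtain k u where y: "bar k = k" "bar u = - u" "y = k + u"
      using bar_cases .
    have a: "asc (bar y') (bar x') s = asc s (bar y') (bar x')" for x' y'
      using asc_skew_right[OF s] asc_skew_left[OF s] by simp
    have b: "asc s t k = - asc s k t" "asc s h u = - asc s u h"
      using asc_skew_right y(2) x(2) by simp_all
    have "asc s (bar (bar y)) (bar x) + asc s (bar x) y = asc s x (bar y) + asc s (bar y) x"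
      by (simp add: x y bar_simps asc_simps b algebra_simps)
    moreover have c: "mul (mul y (bar x)) s = mul y (mul (bar x) s) + asc s y (bar x)"
      using a[of "bar y" x] by (simp add: associator_def algebra_simps)
    ultimately show ?thesis
      by (simp add: struct_V_def s bar_mul mul_simps c) (simp add: associator_def algebra_simps)
  qed
  finally show ?thesis
    using r by simp
qed

lemma V_swap: "V x y z - V z y x = mul (mul x (bar z) - mul z (bar x)) y"
  by (simp add: struct_V_def mul_simps algebra_simps)

context
  fixes \<sigma>
  assumes sigma: "involutive_automorphism scale mul bar \<sigma>"
begin

abbreviation tp where "tp \<equiv> struct_triple mul bar \<sigma>"

lemma sigma_linear: "Vector_Spaces.linear scale scale \<sigma>"
  and sigma_mul: "\<sigma> (mul x y) = mul (\<sigma> x) (\<sigma> y)"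
  and sigma_bar: "\<sigma> (bar x) = bar (\<sigma> x)"
  and sigma_sigma: "\<sigma> (\<sigma> x) = x"
  using sigma by (auto simp: involutive_automorphism_def involution_algebra_automorphism_def)

lemmas sigma_simps = linear_simps[OF sigma_linear]

lemma sigma_one: "\<sigma> one = one"
  by (metis mul_one_left mul_one_right sigma_mul sigma_sigma)

lemma tp_eq_V: "tp x y z = V x (\<sigma> y) z"
  by (simp add: struct_triple_def struct_V_def sigma_bar)

lemma sigma_V: "\<sigma> (V x y z) = V (\<sigma> x) (\<sigma> y) (\<sigma> z)"
  by (simp add: struct_V_def sigma_simps sigma_mul sigma_bar)

lemma left_unital_kts_struct_triple: "left_unital_kantor_triple_system scale tp one"
proof (intro left_unital_kantor_triple_system.intro kantor_triple_system.intro
    triple_system.intro triple_system_axioms.intro kantor_triple_system_axioms.intro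
    left_unital_kantor_triple_system_axioms.intro vector_space_axioms)
  fix u v x y z
  show "Vector_Spaces.linear scale scale (\<lambda>x. tp x y z)"
    "Vector_Spaces.linear scale scale (\<lambda>y. tp x y z)"
    "Vector_Spaces.linear scale scale (tp x y)"
    unfolding struct_triple_def
    by (rule linearI; simp add: mul_simps bar_simps sigma_simps algebra_simps
        scale_right_diff_distrib scale_right_distrib)+
  show "tp one one x = x"
    by (simp add: tp_eq_V sigma_one V_one_left T_def mul_simps)
  show "triple_L tp u v (triple_L tp x y z) - triple_L tp x y (triple_L tp u v z) =
     triple_L tp (tp u v x) y z - triple_L tp x (tp v u y) z"
    using V_commutator[of u "\<sigma> v" x "\<sigma> y" z]
    by (simp add: triple_L_def tp_eq_V sigma_V sigma_sigma)
  have K: "triple_K tp u v z = mul (mul u (bar v) - mul v (bar u)) (\<sigma> z)" for u v z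
    by (simp add: triple_K_def tp_eq_V V_swap)
  have "bar (mul u (bar v) - mul v (bar u)) = - (mul u (bar v) - mul v (bar u))"
    by (simp add: bar_simps bar_mul)
  \<comment> \<open>\<open>\<sigma>\<close> enters through \<open>K\<close>, which turns \<open>x\<close> and \<open>z\<close> into \<open>\<sigma> x\<close> and \<open>\<sigma> z\<close>.\<close>
  from skew_V[OF this, of "\<sigma> x" y "\<sigma> z"]
  show "triple_K tp (triple_K tp u v x) y z =
     triple_K tp u v (triple_L tp x y z) + triple_L tp y x (triple_K tp u v z)"
    by (simp add: K) (simp add: triple_L_def tp_eq_V sigma_V sigma_sigma)
qed

lemma bar_eq_kts_bar: "bar x = kts_bar scale tp one x"
  by (simp add: kts_bar_def scale_two tp_eq_V sigma_one V_one_right T_def mul_simps)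

lemma sigma_eq_kts_sigma: "\<sigma> x = kts_sigma scale tp one x"
proof -
  interpret left_unital_kantor_triple_system scale tp one
    by (rule left_unital_kts_struct_triple)
  have "kts_mu tp one (\<sigma> x) = scale 3 x - scale 2 (kts_rho tp one x)"
    by (simp add: kts_mu_def kts_rho_def scale_two scale_three tp_eq_V sigma_one sigma_sigma
        V_one_left V_one_right T_def algebra_simps)
  then show ?thesis
    using bij_kts_mu[OF char_ne_3] by (simp add: kts_sigma_def bij_def inv_f_eq)
qed

lemma mul_eq_kts_mult: "mul x y = kts_mult tp one bar \<sigma> x y"
  by (simp add: kts_mult_def struct_triple_def sigma_one sigma_bar sigma_sigma mul_simps algebra_simps)

end

end

section \<open>Untwisting and the correspondence\<close>

context left_unital_kts_char
begin

text \<open>Since \<open>\<sigma>\<close> is an automorphism with trivial square, inserting it in the middle argument preserves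
  the Kantor identities. The unit, \<open>\<rho>\<close> and bar stay the same, while \<open>\<mu>\<close> is composed with \<open>\<sigma>\<close>,
  so the new \<open>\<sigma>\<close> is trivial.\<close>

lemma untwisted: "untwisted_kts scale (\<lambda>x y z. tp x (\<sigma> y) z) e"
  (is "untwisted_kts scale ?V e")
proof -
  have "left_unital_kantor_triple_system scale ?V e"
  proof (intro left_unital_kantor_triple_system.intro kantor_triple_system.intro
    triple_system.intro triple_system_axioms.intro kantor_triple_system_axioms.intro
    left_unital_kantor_triple_system_axioms.intro vector_space_axioms)
    fix u v x y z
    show "Vector_Spaces.linear scale scale (\<lambda>x. ?V x y z)"
      "Vector_Spaces.linear scale scale (\<lambda>y. ?V x y z)"
      "Vector_Spaces.linear scale scale (?V x y)"
      by (rule linearI; simp add: tp_simps sigma_simps)+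
    show "?V e e x = x"
      by (simp add: left_unit)
    show "triple_L ?V u v (triple_L ?V x y z) - triple_L ?V x y (triple_L ?V u v z) =
     triple_L ?V (?V u v x) y z - triple_L ?V x (?V v u y) z"
      using L_commutator[of u "\<sigma> v" x "\<sigma> y" z]
      by (simp add: triple_L_def sigma_tp)
    show "triple_K ?V (triple_K ?V u v x) y z =
     triple_K ?V u v (triple_L ?V x y z) + triple_L ?V y x (triple_K ?V u v z)"
      using kantor_K[of u v "\<sigma> x" y "\<sigma> z"]
      by (simp add: triple_L_def triple_K_def sigma_tp)
  qed
  then interpret U: left_unital_kts_char scale ?V e
    by (intro left_unital_kts_char.intro vector_space_char_axioms)
  have "U.\<sigma> x = x" for x
    by (rule U.mu_inj) (simp only: U.mu_sigma, simp add: mu_sigma kts_bar_def)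
  then show ?thesis
    by unfold_locales
qed

lemma structurable_of_kts:
  "structurable_algebra scale (kts_mult tp e bar \<sigma>) bar e"
  "involutive_automorphism scale (kts_mult tp e bar \<sigma>) bar \<sigma>"
  "tp x y z = struct_triple (kts_mult tp e bar \<sigma>) bar \<sigma> x y z"
proof -
  interpret U: untwisted_kts scale "\<lambda>x y z. tp x (\<sigma> y) z" e
    by (rule untwisted)
  have bar: "kts_bar scale (\<lambda>x y z. tp x (\<sigma> y) z) e = bar"
    by (simp add: fun_eq_iff kts_bar_def)
  have mul: "kts_mult (\<lambda>x y z. tp x (\<sigma> y) z) e bar (\<lambda>x. x) = kts_mult tp e bar \<sigma>"
    by (simp add: fun_eq_iff kts_mult_def)
  show "structurable_algebra scale (kts_mult tp e bar \<sigma>) bar e"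
    using U.structurable unfolding bar mul .
  have "bij \<sigma>"
    by (rule bijI') (metis sigma_sigma)+
  then show "involutive_automorphism scale (kts_mult tp e bar \<sigma>) bar \<sigma>"
    by (simp add: involutive_automorphism_def involution_algebra_automorphism_def sigma_linear
        sigma_bar kts_mult_def sigma_simps sigma_tp)
  show "tp x y z = struct_triple (kts_mult tp e bar \<sigma>) bar \<sigma> x y z"
    using U.tp_eq_struct_V[of x "\<sigma> y" z] unfolding bar mul
    by (simp add: struct_V_def struct_triple_def sigma_bar)
qed

end

theorem theorem2p9:
  fixes scaleU :: "'f::field \<Rightarrow> 'u::ab_group_add \<Rightarrow> 'u"
    and tp :: "'u \<Rightarrow> 'u \<Rightarrow> 'u \<Rightarrow> 'u" and e :: 'u
    and scaleA :: "'f \<Rightarrow> 'a::ab_group_add \<Rightarrow> 'a"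
    and mul :: "'a \<Rightarrow> 'a \<Rightarrow> 'a" and bar \<sigma> :: "'a \<Rightarrow> 'a" and one :: 'a
  assumes "CHAR('f) \<noteq> 2" and "CHAR('f) \<noteq> 3"
  shows
    "(left_unital_kantor_triple_system scaleU tp e \<longrightarrow>
       (let \<sigma>U = kts_sigma scaleU tp e;
            barU = kts_bar scaleU tp e;
            mulU = kts_mult tp e barU \<sigma>U
        in structurable_algebra scaleU mulU barU e \<and>
           involutive_automorphism scaleU mulU barU \<sigma>U \<and>
           (\<forall>x y z. tp x y z = struct_triple mulU barU \<sigma>U x y z))) \<and>
     (structurable_algebra scaleA mul bar one \<and> involutive_automorphism scaleA mul bar \<sigma> \<longrightarrow>
       (let tpA = struct_triple mul bar \<sigma>
        in left_unital_kantor_triple_system scaleA tpA one \<and>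
           (\<forall>x. \<sigma> x = kts_sigma scaleA tpA one x) \<and>
           (\<forall>x. bar x = kts_bar scaleA tpA one x) \<and>
           (\<forall>x y. mul x y = kts_mult tpA one bar \<sigma> x y)))"
proof (intro conjI impI)
  assume "left_unital_kantor_triple_system scaleU tp e"
  then interpret left_unital_kantor_triple_system scaleU tp e .
  interpret left_unital_kts_char scaleU tp e
    by unfold_locales (fact assms)+
  show "let \<sigma>U = kts_sigma scaleU tp e;
            barU = kts_bar scaleU tp e;
            mulU = kts_mult tp e barU \<sigma>U
        in structurable_algebra scaleU mulU barU e \<and>
           involutive_automorphism scaleU mulU barU \<sigma>U \<and>
           (\<forall>x y z. tp x y z = struct_triple mulU barU \<sigma>U x y z)"
    unfolding Let_def using structurable_of_kts by blast
next
  assume A: "structurable_algebra scaleA mul bar one \<and> involutive_automorphism scaleA mul bar \<sigma>"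
  then interpret structurable_algebra scaleA mul bar one by blast
  interpret structurable_char scaleA mul bar one
    by unfold_locales (fact assms)+
  show "let tpA = struct_triple mul bar \<sigma>
        in left_unital_kantor_triple_system scaleA tpA one \<and>
           (\<forall>x. \<sigma> x = kts_sigma scaleA tpA one x) \<and>
           (\<forall>x. bar x = kts_bar scaleA tpA one x) \<and>
           (\<forall>x y. mul x y = kts_mult tpA one bar \<sigma> x y)"
    unfolding Let_def
    using A left_unital_kts_struct_triple sigma_eq_kts_sigma bar_eq_kts_bar mul_eq_kts_mult
    by blast
qed

end
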